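(* Let $0\le s\le 1$ and let $H\subset\mathbb{R}$ be a bounded $s$-set. Then $\varliminf^{\mathcal{I}}H<Avg(H)<\varlimsup^{\mathcal{I}}H$, where $\mathcal{I}=\{K\subset\mathbb{R}:\mu^s(K)=0\}$.
   Context: $\mu^s$ denotes the $s$-dimensional Hausdorff measure on $\mathbb{R}$ ($0\le s\le 1$). $H\subset\mathbb{R}$ is an $s$-set if it is $\mu^s$-measurable and $0<\mu^s(H)<+\infty$. For a bounded $s$-set $H$, $Avg(H)=\frac{\int_H x\,d\mu^s}{\mu^s(H)}$. For $H\subset\mathbb{R}$, $y\in\mathbb{R}$: $H^{y-}=H\cap(-\infty,y]$, $H^{y+}=H\cap[y,+\infty)$. For an ideal $\mathcal{I}$ of subsets of $\mathbb{R}$ and bounded $H\notin\mathcal{I}$: $\varlimsup^{\mathcal{I}}H=\inf\{x:H^{x+}\in\mathcal{I}\}$ and $\varliminf^{\mathcal{I}}H=\sup\{x:H^{x-}\in\mathcal{I}\}$.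
   Formalization: For s = 0 the set H is assumed not to be a single point; for H = {p} and s = 0 (counting measure) the lower limit, Avg(H) and the upper limit all equal p, so the strict inequalities fail. *)

theory Defs
  imports "HOL-Analysis.Analysis"
begin

text \<open>The convention for a nonempty set of diameter 0 is \<open>0\<^sup>0 = 1\<close>, so that the
  0-dimensional Hausdorff measure is the counting measure. It has to be spelled out, because
  \<^term>\<open>0 powr (0::real)\<close> is 0 in HOL.\<close>

definition hausdorff_gauge :: "real \<Rightarrow> 'a::metric_space set \<Rightarrow> ennreal" where
  "hausdorff_gauge s U =
     (if U = {} then 0 else if s = 0 then 1 else ennreal (diameter U powr s))"

text \<open>Boundedness is required explicitly because \<^const>\<open>diameter\<close> is meaningless on unbounded
  sets. Empty covering sets are allowed, so finite covers are included.\<close>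

definition hausdorff_covers :: "real \<Rightarrow> 'a::metric_space set \<Rightarrow> (nat \<Rightarrow> 'a set) set" where
  "hausdorff_covers \<delta> A =
     {U. A \<subseteq> (\<Union>i. U i) \<and> (\<forall>i. bounded (U i) \<and> diameter (U i) \<le> \<delta>)}"

definition hausdorff_premeasure :: "real \<Rightarrow> real \<Rightarrow> 'a::metric_space set \<Rightarrow> ennreal" where
  "hausdorff_premeasure s \<delta> A = (INF U\<in>hausdorff_covers \<delta> A. \<Sum>i. hausdorff_gauge s (U i))"

definition hausdorff_outer :: "real \<Rightarrow> 'a::metric_space set \<Rightarrow> ennreal" where
  "hausdorff_outer s A = (SUP \<delta>\<in>{0<..}. hausdorff_premeasure s \<delta> A)"

definition hausdorff_measure :: "real \<Rightarrow> 'a::metric_space measure" where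
  "hausdorff_measure s =
     measure_of UNIV (lambda_system UNIV UNIV (hausdorff_outer s)) (hausdorff_outer s)"

text \<open>The measure is well defined: its measurable sets are exactly the Caratheodory-measurable
  sets, and on them it agrees with the outer measure.\<close>

lemma hausdorff_premeasure_mono:
  "A \<subseteq> B \<Longrightarrow> hausdorff_premeasure s \<delta> A \<le> hausdorff_premeasure s \<delta> B"
  unfolding hausdorff_premeasure_def
  by (rule INF_superset_mono) (auto simp: hausdorff_covers_def)

lemma hausdorff_premeasure_Union:
  "hausdorff_premeasure s \<delta> (\<Union>i. A i) \<le> (\<Sum>i. hausdorff_premeasure s \<delta> (A i))"
    (is "?l \<le> ?r")
proof (rule ennreal_le_epsilon)
  fix e :: real assume e: "0 < e" and fin: "?r < top"
  have "\<exists>U\<in>hausdorff_covers \<delta> (A n). (\<Sum>i. hausdorff_gauge s (U i))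
          \<le> hausdorff_premeasure s \<delta> (A n) + ennreal (e * (1/2) ^ Suc n)" for n
  proof -
    have "hausdorff_premeasure s \<delta> (A n) \<noteq> top"
      using fin by (metis ennreal_suminf_lessD less_irrefl)
    then have "hausdorff_premeasure s \<delta> (A n)
        < hausdorff_premeasure s \<delta> (A n) + ennreal (e * (1/2) ^ Suc n)"
      using e by (simp add: ennreal_add_left_cancel_less[where c = 0, simplified])
    then show ?thesis
      unfolding hausdorff_premeasure_def INF_less_iff by (auto intro: less_imp_le)
  qed
  then obtain U where U: "\<And>n. U n \<in> hausdorff_covers \<delta> (A n)"
    and le: "\<And>n. (\<Sum>i. hausdorff_gauge s (U n i))
          \<le> hausdorff_premeasure s \<delta> (A n) + ennreal (e * (1/2) ^ Suc n)"
    by metis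
  define V where "V k = (case prod_decode k of (n, i) \<Rightarrow> U n i)" for k
  have "U n i = V (prod_encode (n, i))" for n i
    by (simp add: V_def)
  then have "(\<Union>n. A n) \<subseteq> (\<Union>k. V k)"
    using U by (fastforce simp: hausdorff_covers_def)
  then have "V \<in> hausdorff_covers \<delta> (\<Union>n. A n)"
    using U by (auto simp: hausdorff_covers_def V_def split: prod.split)
  then have "?l \<le> (\<Sum>k. hausdorff_gauge s (V k))"
    unfolding hausdorff_premeasure_def by (rule INF_lower)
  also have "\<dots> = (\<Sum>n. \<Sum>i. hausdorff_gauge s (U n i))"
    using suminf_ennreal_2dimen[where f = "\<lambda>(n, i). hausdorff_gauge s (U n i)"]
    by (simp add: V_def case_prod_unfold)
  also have "\<dots> \<le> (\<Sum>n. hausdorff_premeasure s \<delta> (A n) + ennreal (e * (1/2) ^ Suc n))"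
    by (intro suminf_le le) auto
  also have "\<dots> = ?r + (\<Sum>n. ennreal (e * (1/2) ^ Suc n))"
    by (rule suminf_add[symmetric]) auto
  also have "(\<Sum>n. ennreal (e * (1/2) ^ Suc n)) = ennreal (e * 1)"
    using e by (intro suminf_ennreal_eq sums_mult power_half_series) auto
  finally show "?l \<le> ?r + ennreal e" by simp
qed

lemma outer_measure_space_hausdorff_outer: "outer_measure_space UNIV (hausdorff_outer s)"
  unfolding outer_measure_space_def
proof (intro conjI)
  have "hausdorff_premeasure s \<delta> ({} :: 'a set) = 0" if "0 < \<delta>" for \<delta>
    unfolding hausdorff_premeasure_def
    by (rule antisym[OF INF_lower2[where i = "\<lambda>_. {}"]])
       (use that in \<open>auto simp: hausdorff_covers_def hausdorff_gauge_def\<close>)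
  then show "positive UNIV (hausdorff_outer s :: 'a set \<Rightarrow> _)"
    by (simp add: positive_def hausdorff_outer_def)
  show "increasing UNIV (hausdorff_outer s :: 'a set \<Rightarrow> _)"
    unfolding increasing_def hausdorff_outer_def
    by (blast intro: SUP_mono hausdorff_premeasure_mono)
  show "countably_subadditive UNIV (hausdorff_outer s :: 'a set \<Rightarrow> _)"
    unfolding countably_subadditive_def
  proof (intro allI impI)
    fix A :: "nat \<Rightarrow> 'a set"
    show "hausdorff_outer s (\<Union>i. A i) \<le> (\<Sum>i. hausdorff_outer s (A i))"
      unfolding hausdorff_outer_def[of _ "\<Union>i. A i"]
    proof (rule SUP_least)
      fix \<delta> :: real assume "\<delta> \<in> {0<..}"
      then have "(\<Sum>i. hausdorff_premeasure s \<delta> (A i)) \<le> (\<Sum>i. hausdorff_outer s (A i))"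
        by (intro suminf_le) (auto simp: hausdorff_outer_def intro: SUP_upper)
      then show "hausdorff_premeasure s \<delta> (\<Union>i. A i) \<le> (\<Sum>i. hausdorff_outer s (A i))"
        by (rule order_trans[OF hausdorff_premeasure_Union])
    qed
  qed
qed

lemma measure_space_hausdorff:
  "measure_space UNIV (lambda_system UNIV UNIV (hausdorff_outer s)) (hausdorff_outer s)"
  using sigma_algebra.caratheodory_lemma[OF sigma_algebra_Pow[of UNIV]]
    outer_measure_space_hausdorff_outer[of s] by simp

lemma space_hausdorff_measure [simp]: "space (hausdorff_measure s) = UNIV"
  by (simp add: hausdorff_measure_def)

lemma sets_hausdorff_measure:
  "sets (hausdorff_measure s) = lambda_system UNIV UNIV (hausdorff_outer s)"
  using measure_space_hausdorff[of s]
  by (metis hausdorff_measure_def measure_space_def Pow_UNIV subset_UNIV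
      sigma_algebra.sigma_sets_eq sets_measure_of)

lemma emeasure_hausdorff_measure:
  "A \<in> sets (hausdorff_measure s) \<Longrightarrow> emeasure (hausdorff_measure s) A = hausdorff_outer s A"
  using measure_space_hausdorff[of s]
  by (intro emeasure_measure_of[OF hausdorff_measure_def])
     (auto simp: measure_space_def sets_hausdorff_measure)

definition s_set :: "real \<Rightarrow> real set \<Rightarrow> bool" where
  "s_set s H \<longleftrightarrow> H \<in> sets (hausdorff_measure s) \<and>
     0 < emeasure (hausdorff_measure s) H \<and> emeasure (hausdorff_measure s) H < \<infinity>"

definition Avg :: "real \<Rightarrow> real set \<Rightarrow> real" where
  "Avg s H = (LINT x:H|hausdorff_measure s. x) / measure (hausdorff_measure s) H"

text \<open>\<open>\<I>\<close> is meant to be an ideal of subsets of the real line, and \<open>H\<close> a bounded set that is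
  not in \<open>\<I>\<close>; then both sets of reals below are nonempty and bounded on the relevant side.\<close>

definition ideal_limsup :: "real set set \<Rightarrow> real set \<Rightarrow> real" where
  "ideal_limsup \<I> H = Inf {x. H \<inter> {x..} \<in> \<I>}"

definition ideal_liminf :: "real set set \<Rightarrow> real set \<Rightarrow> real" where
  "ideal_liminf \<I> H = Sup {x. H \<inter> {..x} \<in> \<I>}"

text \<open>The null sets are arbitrary subsets of the line, hence the outer measure. (Such sets are
  automatically Caratheodory-measurable.)\<close>

definition hausdorff_null_ideal :: "real \<Rightarrow> real set set" where
  "hausdorff_null_ideal s = {K. hausdorff_outer s K = 0}"

end

theory Submission
  imports Defs
begin

text \<open>The outer measure is additive on sets at positive distance, hence (Caratheodory's criterion)
  every Borel set is measurable, so that the average is a genuine integral. Almost every point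
  of \<open>H\<close> lies between the two \<open>\<I>\<close>-limits, so the average does too; if it were equal to one of
  them, \<open>c\<close> say, then \<open>H - {c}\<close> would be null. For \<open>s > 0\<close> points are null, so \<open>H\<close> would be
  null; for \<open>s = 0\<close> only the empty set is null, so \<open>H\<close> would be a singleton.\<close>

section \<open>Borel sets are Hausdorff measurable\<close>

lemma hausdorff_premeasure_le_outer:
  "0 < \<delta> \<Longrightarrow> hausdorff_premeasure s \<delta> A \<le> hausdorff_outer s A"
  unfolding hausdorff_outer_def by (rule SUP_upper) simp

lemma hausdorff_premeasure_antimono:
  "\<delta> \<le> \<epsilon> \<Longrightarrow> hausdorff_premeasure s \<epsilon> A \<le> hausdorff_premeasure s \<delta> A"
  unfolding hausdorff_premeasure_def
  by (rule INF_superset_mono) (auto simp: hausdorff_covers_def intro: order_trans)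

lemma hausdorff_outer_mono: "A \<subseteq> B \<Longrightarrow> hausdorff_outer s A \<le> hausdorff_outer s B"
  unfolding hausdorff_outer_def by (blast intro: SUP_mono hausdorff_premeasure_mono)

lemma hausdorff_outer_empty [simp]: "hausdorff_outer s {} = 0"
  using outer_measure_space_hausdorff_outer
  by (auto simp: outer_measure_space_def positive_def)

text \<open>\<open>countably_subadditive\<close> speaks of disjoint families only; disjointing the
  sets and monotonicity give the general case.\<close>

lemma hausdorff_outer_Union:
  fixes A :: "nat \<Rightarrow> 'a::metric_space set"
  shows "hausdorff_outer s (\<Union>i. A i) \<le> (\<Sum>i. hausdorff_outer s (A i))"
proof -
  have "hausdorff_outer s (\<Union>i. A i) = hausdorff_outer s (\<Union>i. disjointed A i)"
    by (simp add: UN_disjointed_eq)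
  also have "\<dots> \<le> (\<Sum>i. hausdorff_outer s (disjointed A i))"
    using outer_measure_space_hausdorff_outer[of s, where 'a = 'a] disjoint_family_disjointed[of A]
    unfolding outer_measure_space_def countably_subadditive_def by blast
  also have "\<dots> \<le> (\<Sum>i. hausdorff_outer s (A i))"
    by (intro suminf_le hausdorff_outer_mono disjointed_subset) auto
  finally show ?thesis .
qed

lemma hausdorff_outer_Un: "hausdorff_outer s (A \<union> B) \<le> hausdorff_outer s A + hausdorff_outer s B"
proof -
  let ?F = "\<lambda>i::nat. if i = 0 then A else if i = 1 then B else {}"
  have "A \<union> B \<subseteq> (\<Union>i. ?F i)"
    by (auto intro: exI[of _ "0::nat"] exI[of _ "1::nat"])
  then have "hausdorff_outer s (A \<union> B) \<le> hausdorff_outer s (\<Union>i. ?F i)"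
    by (rule hausdorff_outer_mono)
  also have "\<dots> \<le> (\<Sum>i. hausdorff_outer s (?F i))"
    by (rule hausdorff_outer_Union)
  also have "\<dots> = (\<Sum>i\<in>{0,1}. hausdorff_outer s (?F i))"
    by (rule suminf_finite) auto
  finally show ?thesis by simp
qed

text \<open>A covering set of diameter at most \<open>\<delta>\<close> cannot meet both
  \<open>A\<close> and \<open>B\<close>, so every cover of the union splits into a cover of
  \<open>A\<close> and one of \<open>B\<close> without using any set twice.\<close>

lemma hausdorff_premeasure_separated:
  fixes A B :: "'a::metric_space set"
  assumes sep: "\<And>x y. x \<in> A \<Longrightarrow> y \<in> B \<Longrightarrow> \<delta> < dist x y"
  shows "hausdorff_premeasure s \<delta> A + hausdorff_premeasure s \<delta> B \<le> hausdorff_premeasure s \<delta> (A \<union> B)"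
  unfolding hausdorff_premeasure_def[of _ _ "A \<union> B"]
proof (rule INF_greatest)
  fix U assume U: "U \<in> hausdorff_covers \<delta> (A \<union> B)"
  define V where "V i = (if U i \<inter> A = {} then {} else U i)" for i
  define W where "W i = (if U i \<inter> B = {} then {} else U i)" for i
  have disj: "V i = {} \<or> W i = {}" for i
  proof (rule ccontr)
    assume "\<not> ?thesis"
    then obtain x y where xy: "x \<in> U i" "x \<in> A" "y \<in> U i" "y \<in> B"
      by (auto simp: V_def W_def split: if_splits)
    then have "dist x y \<le> diameter (U i)"
      using U by (intro diameter_bounded_bound) (auto simp: hausdorff_covers_def)
    also have "\<dots> \<le> \<delta>"
      using U by (auto simp: hausdorff_covers_def)
    finally show False
      using sep xy by fastforce
  qed
  \<comment> \<open>The empty sets put into \<open>V\<close> and \<open>W\<close> have diameter 0,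
    which must not exceed \<open>\<delta>\<close>.\<close>
  have \<delta>: "0 \<le> \<delta>"
    using U by (auto simp: hausdorff_covers_def intro: order_trans[OF diameter_ge_0])
  have "V \<in> hausdorff_covers \<delta> A" "W \<in> hausdorff_covers \<delta> B"
    using U \<delta> by (fastforce simp: hausdorff_covers_def V_def W_def)+
  then have "hausdorff_premeasure s \<delta> A + hausdorff_premeasure s \<delta> B
      \<le> (\<Sum>i. hausdorff_gauge s (V i)) + (\<Sum>i. hausdorff_gauge s (W i))"
    unfolding hausdorff_premeasure_def by (intro add_mono INF_lower)
  also have "\<dots> = (\<Sum>i. hausdorff_gauge s (V i) + hausdorff_gauge s (W i))"
    by (rule suminf_add) auto
  also have "\<dots> \<le> (\<Sum>i. hausdorff_gauge s (U i))"
  proof (intro suminf_le allI)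
    fix i
    have "V i = {} \<or> V i = U i" "W i = {} \<or> W i = U i"
      by (auto simp: V_def W_def)
    then show "hausdorff_gauge s (V i) + hausdorff_gauge s (W i) \<le> hausdorff_gauge s (U i)"
      using disj[of i] by (auto simp: hausdorff_gauge_def)
  qed auto
  finally show "hausdorff_premeasure s \<delta> A + hausdorff_premeasure s \<delta> B
      \<le> (\<Sum>i. hausdorff_gauge s (U i))" .
qed

text \<open>At scales below \<open>d\<close> the premeasures already add up. The two scales are kept
  independent so that the two suprema can be taken one after the other.\<close>

lemma hausdorff_outer_separated:
  fixes A B :: "'a::metric_space set"
  assumes "0 < d" and sep: "\<And>x y. x \<in> A \<Longrightarrow> y \<in> B \<Longrightarrow> d \<le> dist x y"
  shows "hausdorff_outer s A + hausdorff_outer s B \<le> hausdorff_outer s (A \<union> B)"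
proof -
  have *: "hausdorff_premeasure s \<delta> A + hausdorff_premeasure s \<epsilon> B \<le> hausdorff_outer s (A \<union> B)"
    if "0 < \<delta>" "0 < \<epsilon>" for \<delta> \<epsilon>
  proof -
    \<comment> \<open>Halving \<open>d\<close> gives the strict inequality that separation at scale
      \<open>\<gamma>\<close> requires.\<close>
    define \<gamma> where "\<gamma> = min (min \<delta> \<epsilon>) (d / 2)"
    have \<gamma>: "0 < \<gamma>" "\<gamma> \<le> \<delta>" "\<gamma> \<le> \<epsilon>" "\<gamma> < d"
      using that \<open>0 < d\<close> by (auto simp: \<gamma>_def)
    have "hausdorff_premeasure s \<delta> A + hausdorff_premeasure s \<epsilon> B
        \<le> hausdorff_premeasure s \<gamma> A + hausdorff_premeasure s \<gamma> B"
      using \<gamma> by (intro add_mono hausdorff_premeasure_antimono)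
    also have "\<dots> \<le> hausdorff_premeasure s \<gamma> (A \<union> B)"
      using sep \<gamma> by (intro hausdorff_premeasure_separated) (meson less_le_trans)
    also have "\<dots> \<le> hausdorff_outer s (A \<union> B)"
      using \<gamma> by (intro hausdorff_premeasure_le_outer)
    finally show ?thesis .
  qed
  have "hausdorff_outer s A + hausdorff_premeasure s \<epsilon> B \<le> hausdorff_outer s (A \<union> B)"
    if "0 < \<epsilon>" for \<epsilon>
    unfolding hausdorff_outer_def[of s A] using * that
    by (subst ennreal_SUP_add_left[symmetric]) (auto intro!: SUP_least)
  then show ?thesis
    unfolding hausdorff_outer_def[of s B]
    by (subst ennreal_SUP_add_right) (auto intro!: SUP_least)
qed

text \<open>The gap \<open>d n\<close> may shrink with \<open>n\<close>: each induction step only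
  separates \<open>E n\<close> from the union of the earlier sets.\<close>

lemma hausdorff_outer_sum_separated:
  fixes E :: "nat \<Rightarrow> 'a::metric_space set"
  assumes d: "\<And>n. 0 < d n"
    and sep: "\<And>k n x y. k < n \<Longrightarrow> x \<in> E k \<Longrightarrow> y \<in> E n \<Longrightarrow> d n \<le> dist x y"
  shows "(\<Sum>k<n. hausdorff_outer s (E k)) \<le> hausdorff_outer s (\<Union>k<n. E k)"
proof (induction n)
  case (Suc n)
  have "(\<Sum>k<Suc n. hausdorff_outer s (E k))
      \<le> hausdorff_outer s (\<Union>k<n. E k) + hausdorff_outer s (E n)"
    using Suc by (simp add: add_right_mono)
  also have "\<dots> \<le> hausdorff_outer s ((\<Union>k<n. E k) \<union> E n)"
    by (rule hausdorff_outer_separated[OF d[of n]]) (use sep in auto)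
  also have "(\<Union>k<n. E k) \<union> E n = (\<Union>k<Suc n. E k)"
    by (auto simp: less_Suc_eq)
  finally show ?case .
qed simp

text \<open>The shells \<open>D k\<close> shrink to \<open>T\<close>. Shells with indices of the same parity are at positive
  distance from each other, which bounds the total outer measure of all shells by twice that
  of \<open>A\<close>; so the tails of the sum tend to 0.\<close>

lemma hausdorff_outer_closed_split:
  fixes A T :: "'a::metric_space set"
  assumes "closed T" "T \<noteq> {}"
  shows "hausdorff_outer s (A \<inter> T) + hausdorff_outer s (A - T) \<le> hausdorff_outer s A"
proof (cases "hausdorff_outer s A = top")
  case False
  let ?\<mu> = "hausdorff_outer s"
  define D where "D k = {y\<in>A. 1 / real (k + 2) \<le> infdist y T \<and> infdist y T < 1 / real (k + 1)}"
    for k :: nat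
  \<comment> \<open>\<open>R n\<close> is the part of \<open>A\<close> outside all shells of index
    at least \<open>n\<close> and away from \<open>T\<close>; it has distance at least
    \<open>1 / real (n + 1)\<close> from \<open>T\<close>.\<close>
  define R where "R n = {y\<in>A. 1 / real (n + 1) \<le> infdist y T}" for n :: nat
  have lip: "infdist x T - infdist y T \<le> dist x y" for x y
    using infdist_triangle[of x T y] by linarith
  \<comment> \<open>\<open>infdist\<close> is 1-Lipschitz in the point. It is at least
    \<open>1 / real (k + 2)\<close> on \<open>D j\<close> and below \<open>1 / real (k + 3)\<close>
    on \<open>D m\<close>, as the shell \<open>k + 1\<close> lies between them.\<close>
  have sepD: "1 / real (k + 2) - 1 / real (k + 3) \<le> dist x y"
    if "x \<in> D j" "y \<in> D m" "j \<le> k" "k + 2 \<le> m" for j k m x y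
  proof -
    have "1 / real (k + 2) \<le> 1 / real (j + 2)" "1 / real (m + 1) \<le> 1 / real (k + 3)"
      using that by (auto simp: field_simps)
    then show ?thesis
      using that lip[of x y] by (auto simp: D_def)
  qed
  have gap: "0 < 1 / real (k + 2) - 1 / real (k + 3)" for k
    by (simp add: frac_less2)
  have parity: "(\<Sum>k<n. ?\<mu> (D (2 * k + p))) \<le> ?\<mu> A" for p n
  proof -
    have "(\<Sum>k<n. ?\<mu> (D (2 * k + p))) \<le> ?\<mu> (\<Union>k<n. D (2 * k + p))"
    proof (rule hausdorff_outer_sum_separated)
      fix k n x y assume *: "k < n" "x \<in> D (2 * k + p)" "y \<in> D (2 * n + p)"
      \<comment> \<open>This is \<open>sepD\<close> with the index two below that of the outer
        argument \<open>2 * n + p\<close>. Here \<open>k < n\<close> forces \<open>n\<close> to be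
        positive, so the subtraction is exact; at \<open>n = 0\<close> it truncates, and
        \<open>gap\<close> still gives a positive value.\<close>
      show "1 / real (2 * n + p - 2 + 2) - 1 / real (2 * n + p - 2 + 3) \<le> dist x y"
        by (rule sepD[OF *(2,3)]) (use * in auto)
    qed (rule gap)
    also have "\<dots> \<le> ?\<mu> A"
      by (rule hausdorff_outer_mono) (auto simp: D_def)
    finally show ?thesis .
  qed
  have "(\<Sum>k<n. ?\<mu> (D k)) \<le> ?\<mu> A + ?\<mu> A" for n
  proof -
    \<comment> \<open>Lengthening the sum to \<open>2 * n\<close> terms lets it split evenly into
      even and odd indices.\<close>
    have "(\<Sum>k<n. ?\<mu> (D k)) \<le> (\<Sum>k<2 * n. ?\<mu> (D k))"
      by (rule sum_mono2) auto
    also have "\<dots> = (\<Sum>k<n. ?\<mu> (D (2 * k + 0))) + (\<Sum>k<n. ?\<mu> (D (2 * k + 1)))"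
      by (induction n) (auto simp: algebra_simps)
    also have "\<dots> \<le> ?\<mu> A + ?\<mu> A"
      by (intro add_mono parity)
    finally show ?thesis .
  qed
  then have "(\<Sum>k. ?\<mu> (D k)) \<le> ?\<mu> A + ?\<mu> A"
    by (intro suminf_le_const) auto
  then have fin: "(\<Sum>k. ?\<mu> (D k)) \<noteq> top"
    using False by (auto simp: top_unique)
  define g where "g k = enn2real (?\<mu> (D k))" for k
  have g: "?\<mu> (D k) = ennreal (g k)" "0 \<le> g k" for k
    using fin by (auto simp: g_def less_top intro!: ennreal_enn2real[symmetric]
        dest: ennreal_suminf_lessD)
  have summ: "summable g"
    using fin g by (intro summable_suminf_not_top) auto
  show ?thesis
  proof (rule ennreal_le_epsilon)
    fix e :: real assume "0 < e"
    then obtain n where n: "\<bar>\<Sum>k. g (k + n)\<bar> < e"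
      using suminf_exist_split[OF _ summ, of e] by auto
    have "A - T \<subseteq> R n \<union> (\<Union>k. D (k + n))"
    proof
      fix y assume y: "y \<in> A - T"
      then have pos: "0 < infdist y T"
        using assms by (simp add: infdist_pos_not_in_closed)
      show "y \<in> R n \<union> (\<Union>k. D (k + n))"
      proof (cases "1 / real (n + 1) \<le> infdist y T")
        case False
        obtain m where m: "1 / real (m + 1) \<le> infdist y T"
          using reals_Archimedean[OF pos] by (auto simp: field_simps intro: less_imp_le)
        \<comment> \<open>The least such index locates the shell of \<open>y\<close>: minimality
          gives the strict upper bound at \<open>l - 1\<close>, so \<open>y\<close> lies in
          \<open>D (l - 1)\<close>.\<close>
        define l where "l = (LEAST m. 1 / real (m + 1) \<le> infdist y T)"
        have l: "1 / real (l + 1) \<le> infdist y T"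
          unfolding l_def by (rule LeastI[of "\<lambda>m. 1 / real (m + 1) \<le> infdist y T", OF m])
        have "n < l"
        proof (rule ccontr)
          assume "\<not> n < l"
          then have "1 / real (n + 1) \<le> 1 / real (l + 1)"
            by (auto simp: field_simps)
          then show False
            using l False by linarith
        qed
        then obtain j where j: "l = Suc (j + n)"
          by (metis add.commute less_imp_Suc_add)
        have "\<not> 1 / real (j + n + 1) \<le> infdist y T"
          using not_less_Least[of "j + n" "\<lambda>m. 1 / real (m + 1) \<le> infdist y T"] j
          by (simp add: l_def)
        then have "y \<in> D (j + n)"
          using l j y by (auto simp: D_def)
        then show ?thesis by blast
      qed (use y in \<open>auto simp: R_def\<close>)
    qed
    then have "?\<mu> (A - T) \<le> ?\<mu> (R n \<union> (\<Union>k. D (k + n)))"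
      by (rule hausdorff_outer_mono)
    also have "\<dots> \<le> ?\<mu> (R n) + ?\<mu> (\<Union>k. D (k + n))"
      by (rule hausdorff_outer_Un)
    also have "\<dots> \<le> ?\<mu> (R n) + (\<Sum>k. ?\<mu> (D (k + n)))"
      by (intro add_left_mono hausdorff_outer_Union)
    also have "(\<Sum>k. ?\<mu> (D (k + n))) = ennreal (\<Sum>k. g (k + n))"
      unfolding g(1) using summ g(2) by (intro suminf_ennreal2) (auto simp: summable_iff_shift)
    also have "\<dots> \<le> ennreal e"
      using n by (intro ennreal_leI) auto
    finally have "?\<mu> (A \<inter> T) + ?\<mu> (A - T) \<le> ?\<mu> (A \<inter> T) + ?\<mu> (R n) + ennreal e"
      by (simp add: add.assoc add_left_mono)
    also have "?\<mu> (A \<inter> T) + ?\<mu> (R n) \<le> ?\<mu> ((A \<inter> T) \<union> R n)"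
    proof (rule hausdorff_outer_separated[where d = "1 / real (n + 1)"])
      fix x y assume "x \<in> A \<inter> T" "y \<in> R n"
      then show "1 / real (n + 1) \<le> dist x y"
        using lip[of y x] by (auto simp: R_def dist_commute)
    qed auto
    also have "\<dots> \<le> ?\<mu> A"
      by (rule hausdorff_outer_mono) (auto simp: R_def)
    finally show "?\<mu> (A \<inter> T) + ?\<mu> (A - T) \<le> ?\<mu> A + ennreal e"
      by (simp add: add_right_mono)
  qed
qed simp

text \<open>One half of the Caratheodory condition is the splitting bound, the other is
  subadditivity. The empty set is treated apart because \<open>infdist\<close> to it is 0 by
  default.\<close>

lemma closed_in_sets_hausdorff:
  fixes T :: "'a::metric_space set"
  assumes "closed T"
  shows "T \<in> sets (hausdorff_measure s)"
proof (cases "T = {}")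
  case False
  have "hausdorff_outer s (T \<inter> A) + hausdorff_outer s ((UNIV - T) \<inter> A) = hausdorff_outer s A" for A
  proof (rule antisym)
    show "hausdorff_outer s (T \<inter> A) + hausdorff_outer s ((UNIV - T) \<inter> A) \<le> hausdorff_outer s A"
      using hausdorff_outer_closed_split[OF assms False, of s A]
      by (simp add: Int_commute Diff_eq)
    have "A = T \<inter> A \<union> (UNIV - T) \<inter> A" by auto
    then show "hausdorff_outer s A \<le> hausdorff_outer s (T \<inter> A) + hausdorff_outer s ((UNIV - T) \<inter> A)"
      using hausdorff_outer_Un by metis
  qed
  then show ?thesis
    by (simp add: sets_hausdorff_measure lambda_system_def)
qed simp

lemma sets_borel_subset_hausdorff: "sets borel \<subseteq> sets (hausdorff_measure s)"
proof -
  have "sigma_sets UNIV (Collect closed) \<subseteq> sets (hausdorff_measure s :: 'a measure)"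
    using sets.sigma_sets_subset[of "Collect closed" "hausdorff_measure s :: 'a measure"]
    by (auto intro: closed_in_sets_hausdorff)
  then show ?thesis
    by (simp add: borel_eq_closed)
qed

section \<open>Null sets\<close>

text \<open>The constant cover by \<open>{c}\<close> costs nothing: for positive \<open>s\<close>
  the gauge of a set of diameter 0 is 0.\<close>

lemma hausdorff_outer_singleton:
  assumes "0 < s"
  shows "hausdorff_outer s {c} = 0"
proof -
  have "hausdorff_premeasure s \<delta> {c} \<le> 0" if "0 < \<delta>" for \<delta>
    unfolding hausdorff_premeasure_def
    by (rule INF_lower2[of "\<lambda>_. {c}"])
       (use that assms in \<open>auto simp: hausdorff_covers_def hausdorff_gauge_def\<close>)
  then show ?thesis
    by (auto simp: hausdorff_outer_def)
qed

text \<open>For \<open>s = 0\<close> any covering set that contains a point of \<open>A\<close>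
  alone contributes 1; the scale 1 is an arbitrary choice.\<close>

lemma hausdorff_outer_0_eq_0_iff: "hausdorff_outer 0 A = 0 \<longleftrightarrow> A = {}"
proof
  assume 0: "hausdorff_outer 0 A = 0"
  show "A = {}"
  proof (rule ccontr)
    assume "A \<noteq> {}"
    then obtain x where x: "x \<in> A" by blast
    have "1 \<le> hausdorff_premeasure 0 1 A"
      unfolding hausdorff_premeasure_def
    proof (rule INF_greatest)
      fix U assume "U \<in> hausdorff_covers 1 A"
      then obtain i where "x \<in> U i"
        using x by (auto simp: hausdorff_covers_def)
      then have "1 = (\<Sum>k\<in>{i}. hausdorff_gauge 0 (U k))"
        by (auto simp: hausdorff_gauge_def)
      also have "\<dots> \<le> (\<Sum>k. hausdorff_gauge 0 (U k))"
        by (rule sum_le_suminf) auto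
      finally show "1 \<le> (\<Sum>k. hausdorff_gauge 0 (U k))" .
    qed
    also have "\<dots> \<le> 0"
      using hausdorff_premeasure_le_outer[of 1 0 A] 0 by simp
    finally show False by simp
  qed
qed simp

section \<open>The null ideal and the parts of \<open>H\<close> beyond its limits\<close>

lemma hausdorff_null_ideal_subset:
  "B \<in> hausdorff_null_ideal s \<Longrightarrow> A \<subseteq> B \<Longrightarrow> A \<in> hausdorff_null_ideal s"
  using hausdorff_outer_mono[of A B s] by (simp add: hausdorff_null_ideal_def)

lemma hausdorff_null_ideal_UN:
  fixes A :: "nat \<Rightarrow> real set"
  shows "(\<And>i. A i \<in> hausdorff_null_ideal s) \<Longrightarrow> (\<Union>i. A i) \<in> hausdorff_null_ideal s"
  using hausdorff_outer_Union[of s A] by (simp add: hausdorff_null_ideal_def)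

text \<open>The supremum need not be attained, so the open half-line is exhausted by countably many
  closed ones, each cutting a null set from \<open>H\<close>.\<close>

lemma below_ideal_liminf_null:
  assumes "bounded H" "H \<notin> hausdorff_null_ideal s"
  shows "H \<inter> {..<ideal_liminf (hausdorff_null_ideal s) H} \<in> hausdorff_null_ideal s"
proof -
  let ?I = "hausdorff_null_ideal s"
  let ?S = "{x. H \<inter> {..x} \<in> ?I}"
  define a where "a = ideal_liminf ?I H"
  obtain B where B: "\<And>x. x \<in> H \<Longrightarrow> \<bar>x\<bar> \<le> B"
    using \<open>bounded H\<close> by (auto simp: bounded_iff)
  \<comment> \<open>A point strictly below \<open>H\<close> shows that the supremum is over a
    nonempty set.\<close>
  have "H \<inter> {..- B - 1} = {}"
    using B by fastforce
  then have ne: "?S \<noteq> {}"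
    by (auto simp: hausdorff_null_ideal_def intro!: exI[of _ "- B - 1"])
  have "H \<inter> {..a - 1 / real (Suc n)} \<in> ?I" for n
  proof -
    have "a - 1 / real (Suc n) < Sup ?S"
      by (simp add: a_def ideal_liminf_def)
    then obtain y where "H \<inter> {..y} \<in> ?I" "a - 1 / real (Suc n) < y"
      using less_cSupE[OF _ ne] by blast
    then show ?thesis
      by (auto intro: hausdorff_null_ideal_subset)
  qed
  then have "(\<Union>n. H \<inter> {..a - 1 / real (Suc n)}) \<in> ?I"
    by (rule hausdorff_null_ideal_UN)
  moreover have "H \<inter> {..<a} \<subseteq> (\<Union>n. H \<inter> {..a - 1 / real (Suc n)})"
  proof
    fix x assume x: "x \<in> H \<inter> {..<a}"
    then obtain n where "inverse (real (Suc n)) < a - x"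
      using reals_Archimedean[of "a - x"] by auto
    then show "x \<in> (\<Union>n. H \<inter> {..a - 1 / real (Suc n)})"
      using x by (auto simp: inverse_eq_divide intro!: exI[of _ n])
  qed
  ultimately show ?thesis
    unfolding a_def by (rule hausdorff_null_ideal_subset)
qed

text \<open>Mirror image of \<open>below_ideal_liminf_null\<close>, with an infimum.\<close>

lemma above_ideal_limsup_null:
  assumes "bounded H" "H \<notin> hausdorff_null_ideal s"
  shows "H \<inter> {ideal_limsup (hausdorff_null_ideal s) H<..} \<in> hausdorff_null_ideal s"
proof -
  let ?I = "hausdorff_null_ideal s"
  let ?S = "{x. H \<inter> {x..} \<in> ?I}"
  define b where "b = ideal_limsup ?I H"
  obtain B where B: "\<And>x. x \<in> H \<Longrightarrow> \<bar>x\<bar> \<le> B"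
    using \<open>bounded H\<close> by (auto simp: bounded_iff)
  have "H \<inter> {B + 1..} = {}"
    using B by fastforce
  then have ne: "?S \<noteq> {}"
    by (auto simp: hausdorff_null_ideal_def intro!: exI[of _ "B + 1"])
  have "H \<inter> {b + 1 / real (Suc n)..} \<in> ?I" for n
  proof -
    have "Inf ?S < b + 1 / real (Suc n)"
      by (simp add: b_def ideal_limsup_def)
    then obtain y where "H \<inter> {y..} \<in> ?I" "y < b + 1 / real (Suc n)"
      using cInf_lessD[OF ne] by blast
    then show ?thesis
      by (auto intro: hausdorff_null_ideal_subset)
  qed
  then have "(\<Union>n. H \<inter> {b + 1 / real (Suc n)..}) \<in> ?I"
    by (rule hausdorff_null_ideal_UN)
  moreover have "H \<inter> {b<..} \<subseteq> (\<Union>n. H \<inter> {b + 1 / real (Suc n)..})"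
  proof
    fix x assume x: "x \<in> H \<inter> {b<..}"
    then obtain n where "inverse (real (Suc n)) < x - b"
      using reals_Archimedean[of "x - b"] by auto
    then show "x \<in> (\<Union>n. H \<inter> {b + 1 / real (Suc n)..})"
      using x by (auto simp: inverse_eq_divide intro!: exI[of _ n])
  qed
  ultimately show ?thesis
    unfolding b_def by (rule hausdorff_null_ideal_subset)
qed

section \<open>The average\<close>

text \<open>The function \<open>f - c\<close> is nonnegative almost everywhere on \<open>H\<close>;
  a zero integral would make it vanish there almost everywhere.\<close>

lemma set_integral_gt_lower_bound:
  fixes f :: "'a \<Rightarrow> real"
  assumes H: "H \<in> sets M" "emeasure M H < \<infinity>"
    and int: "set_integrable M H f"
    and ge: "AE x\<in>H in M. c \<le> f x"
    and ne: "\<not> (AE x\<in>H in M. f x = c)"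
  shows "c * measure M H < (LINT x:H|M. f x)"
proof -
  let ?g = "\<lambda>x. indicator H x * (f x - c)"
  have intc: "set_integrable M H (\<lambda>x. c)"
    using H by (simp add: set_integrable_def)
  have "set_integrable M H (\<lambda>x. f x - c)"
    using int intc by (rule set_integral_diff)
  then have g: "integrable M ?g"
    by (simp add: set_integrable_def)
  have nonneg: "AE x in M. 0 \<le> ?g x"
    using ge by eventually_elim (auto simp: indicator_def)
  have "integral\<^sup>L M ?g \<noteq> 0"
  proof
    assume "integral\<^sup>L M ?g = 0"
    then have "AE x in M. ?g x = 0"
      using integral_nonneg_eq_0_iff_AE[OF g nonneg] by simp
    then have "AE x\<in>H in M. f x = c"
      by eventually_elim (auto simp: indicator_def)
    with ne show False by simp
  qed
  moreover have "0 \<le> integral\<^sup>L M ?g"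
    by (rule integral_nonneg_AE[OF nonneg])
  moreover have "integral\<^sup>L M ?g = (LINT x:H|M. f x) - (LINT x:H|M. c)"
    using set_integral_diff(2)[OF int intc] by (simp add: set_lebesgue_integral_def)
  moreover have "(LINT x:H|M. c) = c * measure M H"
    using H by (simp add: set_lebesgue_integral_def)
  ultimately show ?thesis by linarith
qed

lemma set_integral_lt_upper_bound:
  fixes f :: "'a \<Rightarrow> real"
  assumes "H \<in> sets M" "emeasure M H < \<infinity>"
    and "set_integrable M H f"
    and "AE x\<in>H in M. f x \<le> c"
    and "\<not> (AE x\<in>H in M. f x = c)"
  shows "(LINT x:H|M. f x) < c * measure M H"
  using set_integral_gt_lower_bound[of H M "\<lambda>x. - f x" "- c"] assms
  by (simp add: set_integrable_def set_lebesgue_integral_def)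

lemma s_set_remove_point_not_null:
  assumes "0 \<le> s" "s_set s H" "s = 0 \<Longrightarrow> \<not> is_singleton H"
  shows "H - {c} \<notin> hausdorff_null_ideal s"
proof
  assume "H - {c} \<in> hausdorff_null_ideal s"
  then have null: "hausdorff_outer s (H - {c}) = 0"
    by (simp add: hausdorff_null_ideal_def)
  have pos: "0 < hausdorff_outer s H"
    using \<open>s_set s H\<close> by (auto simp: s_set_def emeasure_hausdorff_measure)
  show False
  proof (cases "s = 0")
    case True
    then have "H \<subseteq> {c}" "H \<noteq> {}"
      using null pos by (auto simp: hausdorff_outer_0_eq_0_iff)
    then show False
      using assms(3)[OF True] by (auto simp: is_singleton_def subset_singleton_iff)
  next
    case False
    have "hausdorff_outer s H \<le> hausdorff_outer s ((H - {c}) \<union> {c})"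
      by (rule hausdorff_outer_mono) auto
    also have "\<dots> \<le> 0"
      using hausdorff_outer_Un[of s "H - {c}" "{c}"] null
        hausdorff_outer_singleton[of s c] False \<open>0 \<le> s\<close> by simp
    finally show False
      using pos by simp
  qed
qed

text \<open>The last hypothesis excludes one-point sets for \<open>s = 0\<close>. There the measure
  counts points, and for \<open>H = {c}\<close> the average and both limits equal \<open>c\<close>,
  so the strict inequalities of the English statement fail.\<close>

theorem proposition4p3:
  fixes s :: real and H :: "real set"
  assumes "0 \<le> s" and "s \<le> 1"
    and "bounded H" and "s_set s H"
    and "s = 0 \<Longrightarrow> \<not> is_singleton H"
  shows "ideal_liminf (hausdorff_null_ideal s) H < Avg s H
       \<and> Avg s H < ideal_limsup (hausdorff_null_ideal s) H"
proof -
  let ?I = "hausdorff_null_ideal s"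
  define M :: "real measure" where "M = hausdorff_measure s"
  have H: "H \<in> sets M" "0 < emeasure M H" "emeasure M H < \<infinity>"
    using \<open>s_set s H\<close> by (auto simp: s_set_def M_def)
  have borel: "B \<in> sets M" if "B \<in> sets borel" for B
    using that sets_borel_subset_hausdorff by (auto simp: M_def)
  \<comment> \<open>A Borel exceptional set meets \<open>H\<close> in a measurable set, where
    measure and outer measure agree; so "almost everywhere" becomes membership in the ideal.\<close>
  have AE_iff: "(AE x\<in>H in M. P x) \<longleftrightarrow> H \<inter> {x. \<not> P x} \<in> ?I"
    if "{x. \<not> P x} \<in> sets borel" for P
  proof -
    have "H \<inter> {x. \<not> P x} \<in> sets M"
      using H borel[OF that] by blast
    moreover have "{x \<in> space M. \<not> (x \<in> H \<longrightarrow> P x)} = H \<inter> {x. \<not> P x}"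
      by (auto simp: M_def)
    ultimately show ?thesis
      by (subst AE_iff_measurable[where N = "H \<inter> {x. \<not> P x}"])
         (auto simp: M_def emeasure_hausdorff_measure hausdorff_null_ideal_def)
  qed
  have notnull: "H \<notin> ?I"
    using H by (auto simp: M_def emeasure_hausdorff_measure hausdorff_null_ideal_def)
  have ne: "\<not> (AE x\<in>H in M. x = c)" for c
  proof -
    have "{x. x \<noteq> c} = - {c}" "H \<inter> {x. x \<noteq> c} = H - {c}"
      by auto
    then show ?thesis
      using s_set_remove_point_not_null[OF assms(1,4,5), of c]
      by (subst AE_iff) auto
  qed
  have lower: "AE x\<in>H in M. ideal_liminf ?I H \<le> x"
    using below_ideal_liminf_null[OF \<open>bounded H\<close> notnull]
    by (subst AE_iff) (auto simp: not_le lessThan_def)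
  have upper: "AE x\<in>H in M. x \<le> ideal_limsup ?I H"
    using above_ideal_limsup_null[OF \<open>bounded H\<close> notnull]
    by (subst AE_iff) (auto simp: not_le greaterThan_def)
  obtain B where B: "\<And>x. x \<in> H \<Longrightarrow> \<bar>x\<bar> \<le> B"
    using \<open>bounded H\<close> by (auto simp: bounded_iff)
  have meas: "(\<lambda>x. x) \<in> borel_measurable M"
    using borel by (auto simp: measurable_def M_def)
  \<comment> \<open>A bounded function on a set of finite measure; without integrability the
    integral in \<open>Avg\<close> would be the default 0.\<close>
  have int: "set_integrable M H (\<lambda>x. x)"
    unfolding set_integrable_def
    by (rule integrableI_bounded_set_indicator[where B = B])
       (use H meas B in auto)
  have pos: "0 < measure M H"
    using H by (simp add: measure_def enn2real_positive_iff)
  have "Avg s H = (LINT x:H|M. x) / measure M H"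
    by (simp add: Avg_def M_def)
  then show ?thesis
    using set_integral_gt_lower_bound[OF H(1,3) int lower ne]
      set_integral_lt_upper_bound[OF H(1,3) int upper ne] pos
    by (simp add: pos_less_divide_eq pos_divide_less_eq)
qed

end
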